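(* For every integer $n\ge 1$: (i) $\displaystyle\sum_{k=1}^n s(n,k)\,B_{k-1} = (-1)^{n-1}(n-1)!\,H_n$; (ii) $\displaystyle B_{n-1} = \sum_{k=1}^n S(n,k)(-1)^{k-1}(k-1)!\,H_k$, equivalently $B_n = \sum_{k=1}^{n+1} S(n+1,k)(-1)^{k-1}(k-1)!\,H_k$; (iii) $\displaystyle\sum_{k=1}^n s(n,k)\,B_{k-1}(-1)^k = \frac{(-1)^n n!}{n^2}$; (iv) $\displaystyle B_{n-1} = (-1)^n\sum_{k=1}^n S(n,k)\frac{k!}{k^2}(-1)^k$, equivalently $B_n = (-1)^{n+1}\sum_{k=1}^{n+1} S(n+1,k)\frac{k!}{k^2}(-1)^k$.
   Context: $s(n,k)$ are the signed Stirling numbers of the first kind ($x(x-1)\cdots(x-n+1)=\sum_k s(n,k)x^k$), $S(n,k)$ the Stirling numbers of the second kind, $H_n = 1+\tfrac12+\dots+\tfrac1n$ the harmonic numbers. The Bernoulli numbers $B_n$ are defined by $\frac{t}{e^t-1} = \sum_{n\ge0} B_n \frac{t^n}{n!}$ (so $B_1=-\tfrac12$). *)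

theory Defs
  imports
    "HOL-Analysis.Harmonic_Numbers"
    "HOL-Combinatorics.Stirling"
    "HOL-Computational_Algebra.Computational_Algebra"
begin

text \<open>
  \<^const>\<open>stirling\<close> is the unsigned variant; the signed numbers are the coefficients of the
  falling factorial \<open>x (x - 1) \<dots> (x - n + 1)\<close>.
\<close>

definition signed_stirling :: "nat \<Rightarrow> nat \<Rightarrow> int" where
  "signed_stirling n k = coeff (\<Prod>i<n. [:- int i, 1:]) k"

text \<open>
  The denominator has a zero constant term, so the quotient is a division of power series by a
  non-unit; \<open>bernoulli_fps\<close> below shows that it is exact.
\<close>

definition bernoulli :: "nat \<Rightarrow> real" where
  "bernoulli n = fact n * fps_nth (fps_X / (fps_exp 1 - 1)) n"

lemma bernoulli_fps:
  "Abs_fps (\<lambda>n. bernoulli n / fact n) * (fps_exp 1 - 1) = fps_X"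
proof -
  let ?e = "fps_exp 1 - 1 :: real fps"
  have nz: "?e \<noteq> 0"
  proof
    assume "?e = 0"
    hence "fps_nth ?e 1 = 0" by (simp only: fps_zero_nth)
    thus False by simp
  qed
  have "subdegree ?e = 1"
    by (rule subdegreeI) auto
  hence "?e dvd fps_X"
    using nz by (subst fps_dvd_iff) auto
  moreover have "Abs_fps (\<lambda>n. bernoulli n / fact n) = fps_X / ?e"
    by (rule fps_ext) (simp add: bernoulli_def)
  ultimately show ?thesis by simp
qed

lemma signed_stirling_0: "signed_stirling 0 k = (if k = 0 then 1 else 0)"
  by (simp add: signed_stirling_def)

lemma signed_stirling_Suc_0: "signed_stirling (Suc n) 0 = - int n * signed_stirling n 0"
  by (simp add: signed_stirling_def mult.commute)

lemma signed_stirling_Suc_Suc: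
  "signed_stirling (Suc n) (Suc k) = signed_stirling n k - int n * signed_stirling n (Suc k)"
  by (simp add: signed_stirling_def mult.commute)

lemma signed_stirling_eq: "signed_stirling n k = (-1) ^ (n + k) * int (stirling n k)"
proof (induction n arbitrary: k)
  case 0
  show ?case by (cases k) (auto simp: signed_stirling_0)
next
  case (Suc n)
  note IH = Suc.IH
  show ?case
  proof (cases k)
    case 0
    then show ?thesis
      by (cases "n = 0") (simp_all add: signed_stirling_Suc_0 IH)
  next
    case (Suc j)
    then show ?thesis
      by (simp add: signed_stirling_Suc_Suc IH algebra_simps)
  qed
qed

end

theory Submission
  imports Defs
begin

text \<open>
  Let \<open>L\<close> be the linear functional on real polynomials with \<open>L(x^k) = B_k\<close>. The generating
  function of the Bernoulli numbers says that \<open>L(p(x + 1)) = L(p) + p'(0) = L(p(-x))\<close>.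
  Write \<open>(x)_m\<close> for the falling factorial and \<open>p_m = (x - 1) \<dots> (x - m)\<close>, so that
  \<open>(x)_(m+1) = x p_m\<close> and \<open>p_m(x + 1) = (x)_m\<close>. Applying the shift rule to \<open>(x)_(m+1)\<close>, whose
  forward difference is \<open>(m + 1) (x)_m\<close>, gives \<open>L((x)_m) = (-1)^m m! / (m + 1)\<close>; applying it to
  \<open>p_m\<close> gives \<open>L(p_m) = (-1)^m m! H_(m+1)\<close>. The sums (i) and (iii) are \<open>L(p_(n-1))\<close> and
  \<open>-L(p_(n-1)(-x)) = -L((x)_(n-1))\<close>, while (ii) and (iv) arise by applying \<open>L\<close> to
  \<open>x^(n-1) = \<Sum>k. S(n,k) p_(k-1)\<close>, before and after substituting \<open>-x\<close>.
\<close>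

section \<open>The Bernoulli functional and its linearity\<close>

definition bernoulli_functional :: "real poly \<Rightarrow> real" where
  "bernoulli_functional p = (\<Sum>k\<le>degree p. coeff p k * bernoulli k)"

lemma bernoulli_functional_eq_sum:
  assumes "degree p \<le> N"
  shows "bernoulli_functional p = (\<Sum>k\<le>N. coeff p k * bernoulli k)"
  unfolding bernoulli_functional_def using assms
  by (intro sum.mono_neutral_left) (auto simp: coeff_eq_0)

lemma bernoulli_functional_add:
  "bernoulli_functional (p + q) = bernoulli_functional p + bernoulli_functional q"
proof -
  let ?N = "max (degree p) (degree q)"
  have "bernoulli_functional (p + q) = (\<Sum>k\<le>?N. coeff (p + q) k * bernoulli k)"
    by (intro bernoulli_functional_eq_sum degree_add_le_max)
  then show ?thesis
    by (simp add: bernoulli_functional_eq_sum[of p ?N] bernoulli_functional_eq_sum[of q ?N]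
        distrib_right sum.distrib)
qed

lemma bernoulli_functional_smult:
  "bernoulli_functional (smult c p) = c * bernoulli_functional p"
  by (subst bernoulli_functional_eq_sum[OF degree_smult_le])
    (simp add: bernoulli_functional_def sum_distrib_left mult.assoc)

lemma bernoulli_functional_sum:
  "bernoulli_functional (\<Sum>i\<in>A. f i) = (\<Sum>i\<in>A. bernoulli_functional (f i))"
proof (induction A rule: infinite_finite_induct)
  case (insert a A)
  then show ?case by (simp add: bernoulli_functional_add)
qed (simp_all add: bernoulli_functional_def)

lemma bernoulli_functional_x_power: "bernoulli_functional ([:0, 1:] ^ k) = bernoulli k"
  by (simp add: bernoulli_functional_eq_sum[of _ k] monom_altdef[symmetric, of 1, simplified]
      degree_monom_le sum.delta if_distrib[of "\<lambda>c. c * _"] cong: if_cong)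

text \<open>By linearity, a substitution is controlled by the values on powers of \<open>q\<close>
  alone; it is used for \<open>q = x + 1\<close> and \<open>q = -x\<close>.\<close>

lemma bernoulli_functional_pcompose:
  "bernoulli_functional (pcompose p q)
     = (\<Sum>k\<le>degree p. coeff p k * bernoulli_functional (q ^ k))"
proof -
  have "pcompose p q = (\<Sum>k\<le>degree p. smult (coeff p k) (q ^ k))"
    by (simp add: pcompose_altdef poly_altdef degree_map_poly coeff_map_poly)
  then show ?thesis
    by (simp add: bernoulli_functional_sum bernoulli_functional_smult)
qed

section \<open>Shift and reflection rules from the generating function\<close>

lemma bernoulli_binomial_sum:
  "(\<Sum>i\<le>k. real (k choose i) * bernoulli i) = bernoulli k + (if k = 1 then 1 else 0)"
proof -
  let ?B = "Abs_fps (\<lambda>n. bernoulli n / fact n)"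
  \<comment> \<open>The defining relation \<open>B (e^t - 1) = t\<close>, rearranged. The factor
    \<open>k!\<close> then turns the Cauchy product with \<open>e^t\<close> into a binomial
    sum.\<close>
  have "?B * fps_exp 1 = ?B + fps_X"
    using bernoulli_fps by (simp add: algebra_simps)
  then have "fact k * fps_nth (?B * fps_exp 1) k = fact k * fps_nth (?B + fps_X) k"
    by simp
  moreover have "fact k * fps_nth (?B * fps_exp 1) k = (\<Sum>i\<le>k. real (k choose i) * bernoulli i)"
    by (auto simp: fps_mult_nth atLeast0AtMost sum_distrib_left binomial_fact intro!: sum.cong)
  ultimately show ?thesis
    by (auto simp: distrib_left)
qed

text \<open>This is \<open>B(-t) = B(t) + t\<close> read off coefficientwise: both sides give
  \<open>t e^t\<close> when multiplied by \<open>e^t - 1\<close>, which can be cancelled.\<close>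

lemma bernoulli_reflect: "(-1) ^ k * bernoulli k = bernoulli k + (if k = 1 then 1 else 0)"
proof -
  let ?B = "Abs_fps (\<lambda>n. bernoulli n / fact n)"
  let ?C = "Abs_fps (\<lambda>n. (-1) ^ n * (bernoulli n / fact n))"
  let ?e = "fps_exp 1 - 1 :: real fps"
  have nz: "?e \<noteq> 0"
    using bernoulli_fps by (metis fps_X_neq_zero mult_zero_right)
  have refl: "?C * (fps_exp (-1) - 1) = - fps_X"
  proof (rule fps_ext)
    fix n
    \<comment> \<open>The substitution of \<open>-t\<close> for \<open>t\<close>, done by splitting
      the sign over the Cauchy product.\<close>
    have "fps_nth (?C * (fps_exp (-1) - 1)) n = (-1) ^ n * fps_nth (?B * ?e) n"
      unfolding fps_mult_nth sum_distrib_left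
    proof (rule sum.cong)
      fix i assume "i \<in> {0..n}"
      then have "(-1::real) ^ n = (-1) ^ i * (-1) ^ (n - i)"
        by (simp flip: power_add)
      then show "fps_nth ?C i * fps_nth (fps_exp (-1) - 1) (n - i) =
          (-1) ^ n * (fps_nth ?B i * fps_nth ?e (n - i))"
        by simp
    qed simp
    also have "\<dots> = fps_nth (- fps_X) n"
      by (simp add: bernoulli_fps)
    finally show "fps_nth (?C * (fps_exp (-1) - 1)) n = fps_nth (- fps_X) n" .
  qed
  have inv: "fps_exp (-1) * fps_exp 1 = (1 :: real fps)"
    by (simp flip: fps_exp_add_mult)
  have "?C * ?e = - (?C * (fps_exp (-1) - 1)) * fps_exp 1"
    using inv by (simp add: algebra_simps)
  also have "\<dots> = fps_X * fps_exp 1"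
    by (simp only: refl minus_minus)
  also have "\<dots> = (?B + fps_X) * ?e"
    using bernoulli_fps by (simp add: algebra_simps)
  finally have "?C = ?B + fps_X"
    using nz by simp
  then have "fact k * fps_nth ?C k = fact k * fps_nth (?B + fps_X) k"
    by simp
  then show ?thesis
    by (auto simp: distrib_left)
qed

lemma bernoulli_functional_x_plus_1_power:
  "bernoulli_functional ([:1, 1:] ^ k) = bernoulli k + (if k = 1 then 1 else 0)"
proof -
  have "bernoulli_functional ([:1, 1:] ^ k) = (\<Sum>i\<le>k. real (k choose i) * bernoulli i)"
    by (subst bernoulli_functional_eq_sum[of _ k])
      (auto simp: degree_linear_power coeff_linear_poly_power intro!: sum.cong)
  then show ?thesis
    by (simp only: bernoulli_binomial_sum)
qed

lemma bernoulli_functional_minus_x_power: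
  "bernoulli_functional ([:0, -1:] ^ k) = bernoulli k + (if k = 1 then 1 else 0)"
proof -
  have "[:0, -1:] ^ k = smult ((-1) ^ k) ([:0, 1:] ^ k :: real poly)"
    by (simp flip: smult_power)
  then show ?thesis
    by (simp only: bernoulli_functional_smult bernoulli_functional_x_power bernoulli_reflect)
qed

lemma bernoulli_functional_shift:
  "bernoulli_functional (pcompose p [:1, 1:]) = bernoulli_functional p + coeff p 1"
  by (simp only: bernoulli_functional_pcompose bernoulli_functional_x_plus_1_power)
    \<comment> \<open>Only the correction at \<open>k = 1\<close> survives; for constant
      \<open>p\<close> that index lies outside the sum, but then \<open>coeff p 1\<close> is zero as
      well.\<close>
    (auto simp: bernoulli_functional_def distrib_left sum.distrib
      if_distrib[of "\<lambda>c. _ * c"] coeff_eq_0 cong: if_cong)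

text \<open>The functional takes the same value on \<open>(x + 1)^k\<close> and
  \<open>(-x)^k\<close> for every \<open>k\<close>.\<close>

lemma bernoulli_functional_reflect:
  "bernoulli_functional (pcompose p [:0, -1:]) = bernoulli_functional (pcompose p [:1, 1:])"
  by (simp only: bernoulli_functional_pcompose bernoulli_functional_x_plus_1_power
      bernoulli_functional_minus_x_power)

section \<open>Falling factorials and Stirling numbers\<close>

definition falling_poly :: "nat \<Rightarrow> real poly" where
  "falling_poly n = (\<Prod>i<n. [:- real i, 1:])"

definition falling_quot_poly :: "nat \<Rightarrow> real poly" where
  "falling_quot_poly m = (\<Prod>i<m. [:- real (Suc i), 1:])"

lemma falling_poly_Suc: "falling_poly (Suc n) = [:- real n, 1:] * falling_poly n"
  by (simp add: falling_poly_def mult.commute)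

lemma falling_poly_Suc_eq_x_mult: "falling_poly (Suc m) = [:0, 1:] * falling_quot_poly m"
  unfolding falling_poly_def falling_quot_poly_def by (subst prod.lessThan_Suc_shift) simp

lemma falling_quot_poly_shift: "pcompose (falling_quot_poly m) [:1, 1:] = falling_poly m"
  by (simp add: falling_quot_poly_def falling_poly_def pcompose_prod pcompose_pCons)

lemma coeff_falling_poly: "coeff (falling_poly n) k = real_of_int (signed_stirling n k)"
proof (induction n arbitrary: k)
  case 0
  show ?case by (simp add: falling_poly_def signed_stirling_0)
next
  case (Suc n)
  then show ?case
    by (cases k) (simp_all add: falling_poly_Suc signed_stirling_Suc_0 signed_stirling_Suc_Suc)
qed

text \<open>Dividing by \<open>x\<close> lowers every index by one, which is why
  \<open>s(n,k)\<close> gets paired with \<open>B_(k-1)\<close>.\<close>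

lemma coeff_falling_quot_poly:
  "coeff (falling_quot_poly m) k = real_of_int (signed_stirling (Suc m) (Suc k))"
  by (simp add: falling_poly_Suc_eq_x_mult flip: coeff_falling_poly)

lemma degree_falling_quot_poly: "degree (falling_quot_poly m) \<le> m"
  unfolding falling_quot_poly_def
  by (rule order_trans[OF degree_prod_sum_le]) auto

lemma x_power_eq_sum_Stirling:
  "[:0, 1:] ^ n = (\<Sum>k\<le>n. smult (real (Stirling n k)) (falling_poly k))"
proof (induction n)
  case 0
  show ?case by (simp add: falling_poly_def)
next
  case (Suc n)
  have step: "[:0, 1:] * falling_poly k = falling_poly (Suc k) + smult (real k) (falling_poly k)"
    for k
    by (simp add: falling_poly_Suc)
  have "[:0, 1:] ^ Suc n
      = (\<Sum>k\<le>n. smult (real (Stirling n k)) ([:0, 1:] * falling_poly k))"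
    by (simp only: power_Suc Suc.IH sum_distrib_left mult_smult_right)
  \<comment> \<open>The second sum may run up to \<open>Suc n\<close> since
    \<open>S(n,n+1) = 0\<close>; this aligns it with the recurrence for
    \<open>S(n+1,k)\<close>.\<close>
  also have "\<dots> = (\<Sum>k\<le>n. smult (real (Stirling n k)) (falling_poly (Suc k)))
      + (\<Sum>k\<le>Suc n. smult (real k * real (Stirling n k)) (falling_poly k))"
    unfolding step by (simp add: smult_add_right sum.distrib mult.commute)
  also have "\<dots> = (\<Sum>k\<le>Suc n. smult (real (Stirling (Suc n) k)) (falling_poly k))"
    by (simp add: sum.atMost_Suc_shift[of _ n] smult_add_left distrib_right sum.distrib
        del: sum.atMost_Suc)
  finally show ?case .
qed

lemma x_power_eq_sum_Stirling_falling_quot_poly: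
  "[:0, 1:] ^ m
     = (\<Sum>k=1..Suc m. smult (real (Stirling (Suc m) k)) (falling_quot_poly (k - 1)))"
proof -
  \<comment> \<open>The term \<open>k = 0\<close> vanishes because \<open>S(m+1,0) = 0\<close>, so
    every remaining term has a factor \<open>x\<close> to cancel.\<close>
  have "[:0, 1:] * [:0, 1:] ^ m
      = (\<Sum>k\<le>m. smult (real (Stirling (Suc m) (Suc k))) (falling_poly (Suc k)))"
    using x_power_eq_sum_Stirling[of "Suc m"]
    by (simp add: sum.atMost_Suc_shift del: sum.atMost_Suc Stirling.simps(4))
  also have "\<dots> = [:0, 1:] *
      (\<Sum>k\<le>m. smult (real (Stirling (Suc m) (Suc k))) (falling_quot_poly k))"
    by (simp only: falling_poly_Suc_eq_x_mult sum_distrib_left mult_smult_right)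
  finally have "[:0, 1:] ^ m
      = (\<Sum>k\<le>m. smult (real (Stirling (Suc m) (Suc k))) (falling_quot_poly k))"
    by (subst (asm) mult_cancel_left) simp
  then show ?thesis
    by (simp only: sum.atLeast1_atMost_eq lessThan_Suc_atMost diff_Suc_Suc diff_zero One_nat_def)
qed

section \<open>Values of the functional on falling factorials\<close>

lemma bernoulli_functional_falling_poly:
  "bernoulli_functional (falling_poly m) = (-1) ^ m * fact m / real (Suc m)"
proof -
  let ?f = "falling_poly (Suc m)"
  have "pcompose ?f [:1, 1:] = [:1, 1:] * falling_poly m"
    by (simp only: falling_poly_Suc_eq_x_mult pcompose_mult falling_quot_poly_shift)
      (simp add: pcompose_pCons)
  \<comment> \<open>Splits \<open>x + 1\<close> as \<open>(x - m) + (m + 1)\<close>.\<close>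
  also have "\<dots> = ?f + smult (real (Suc m)) (falling_poly m)"
    by (simp add: falling_poly_Suc smult_add_left algebra_simps)
  finally have "coeff ?f 1 = real (Suc m) * bernoulli_functional (falling_poly m)"
    using bernoulli_functional_shift[of ?f]
    by (simp add: bernoulli_functional_add bernoulli_functional_smult)
  moreover have "coeff ?f 1 = (-1) ^ m * fact m"
    by (simp add: coeff_falling_poly signed_stirling_eq stirling_Suc_n_1
        del: stirling.simps)
  ultimately show ?thesis
    by (simp add: field_simps)
qed

lemma bernoulli_functional_falling_quot_poly:
  "bernoulli_functional (falling_quot_poly m) = (-1) ^ m * fact m * harm (Suc m)"
proof -
  \<comment> \<open>The coefficient is \<open>s(m+1,2)\<close>, whose absolute value is
    \<open>m! H_m\<close>. In the shift rule below, the new term \<open>1/(m+1)\<close> completes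
    \<open>H_m\<close> to \<open>H_(m+1)\<close>.\<close>
  have "coeff (falling_quot_poly m) 1 = - ((-1) ^ m * fact m * harm m)"
    using of_nat_stirling_Suc_n_2[of m, where 'a = real]
    by (cases "m = 0") (simp_all add: harm_def inverse_eq_divide coeff_falling_quot_poly signed_stirling_eq numeral_2_eq_2
        del: stirling.simps)
  then have "bernoulli_functional (falling_quot_poly m)
      = (-1) ^ m * fact m / real (Suc m) + (-1) ^ m * fact m * harm m"
    using bernoulli_functional_shift[of "falling_quot_poly m"]
    by (simp add: falling_quot_poly_shift bernoulli_functional_falling_poly)
  then show ?thesis
    by (simp add: harm_Suc distrib_left inverse_eq_divide)
qed

text \<open>Reflection may be traded for the shift, which yields \<open>(x)_m\<close>; the value
  \<open>m!/(m+1)\<close> is rewritten as \<open>(m+1)!/(m+1)^2\<close> to match (iii).\<close>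

lemma bernoulli_functional_falling_quot_poly_reflect:
  "bernoulli_functional (pcompose (falling_quot_poly m) [:0, -1:])
     = (-1) ^ m * fact (Suc m) / (real (Suc m))\<^sup>2"
  by (simp only: bernoulli_functional_reflect falling_quot_poly_shift
      bernoulli_functional_falling_poly) (simp add: power2_eq_square field_simps del: of_nat_Suc)

section \<open>The four identities\<close>

lemma sum_signed_stirling_bernoulli:
  assumes "n \<ge> 1"
  shows "(\<Sum>k=1..n. real_of_int (signed_stirling n k) * bernoulli (k - 1))
    = (-1) ^ (n - 1) * fact (n - 1) * harm n"
proof -
  obtain m where n: "n = Suc m"
    using assms by (cases n) auto
  show ?thesis
    using bernoulli_functional_eq_sum[OF degree_falling_quot_poly, of m]
    by (simp only: n sum.atLeast1_atMost_eq lessThan_Suc_atMost diff_Suc_Suc diff_zero One_nat_def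
        coeff_falling_quot_poly bernoulli_functional_falling_quot_poly)
qed

lemma sum_signed_stirling_bernoulli_alternating:
  assumes "n \<ge> 1"
  shows "(\<Sum>k=1..n. real_of_int (signed_stirling n k) * bernoulli (k - 1) * (-1) ^ k)
    = (-1) ^ n * fact n / (real n)\<^sup>2"
proof -
  obtain m where n: "n = Suc m"
    using assms by (cases n) auto
  let ?q = "pcompose (falling_quot_poly m) [:0, -1:]"
  have "degree ?q \<le> m"
    using degree_falling_quot_poly[of m] by (simp add: degree_pcompose)
  then have "bernoulli_functional ?q = (\<Sum>k\<le>m. coeff ?q k * bernoulli k)"
    by (rule bernoulli_functional_eq_sum)
  \<comment> \<open>Substituting \<open>-x\<close> gives the sign \<open>(-1)^k\<close>, while the
    sum in (iii) has \<open>(-1)^(k+1)\<close> after reindexing; hence the minus.\<close>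
  also have "\<dots> = - (\<Sum>k\<le>m. real_of_int (signed_stirling (Suc m) (Suc k)) * bernoulli k
      * (-1) ^ Suc k)"
    by (simp add: coeff_pcompose_linear coeff_falling_quot_poly mult_ac flip: sum_negf)
  finally show ?thesis
    unfolding bernoulli_functional_falling_quot_poly_reflect
    by (simp only: n sum.atLeast1_atMost_eq lessThan_Suc_atMost diff_Suc_Suc diff_zero One_nat_def) simp
qed

lemma bernoulli_eq_sum_Stirling_harm:
  "bernoulli m
     = (\<Sum>k=1..Suc m. real (Stirling (Suc m) k) * (-1) ^ (k - 1) * fact (k - 1) * harm k)"
proof -
  have "bernoulli m = (\<Sum>k=1..Suc m. real (Stirling (Suc m) k)
      * bernoulli_functional (falling_quot_poly (k - 1)))"
    by (simp only: bernoulli_functional_sum bernoulli_functional_smult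
        x_power_eq_sum_Stirling_falling_quot_poly flip: bernoulli_functional_x_power)
  also have "\<dots> = (\<Sum>k=1..Suc m. real (Stirling (Suc m) k) * (-1) ^ (k - 1) * fact (k - 1) * harm k)"
    by (intro sum.cong) (auto simp: bernoulli_functional_falling_quot_poly mult.assoc
        simp del: Stirling.simps)
  finally show ?thesis .
qed

lemma bernoulli_eq_sum_Stirling_fact:
  "bernoulli m
     = (-1) ^ Suc m * (\<Sum>k=1..Suc m. real (Stirling (Suc m) k) * (fact k / (real k)\<^sup>2) * (-1) ^ k)"
proof -
  have "smult ((-1) ^ m) ([:0, 1:] ^ m) = ([:0, -1:] ^ m :: real poly)"
    by (simp flip: smult_power)
  also have "\<dots> = pcompose ([:0, 1:] ^ m) [:0, -1:]"
    by (induction m) (simp_all add: pcompose_mult pcompose_pCons pcompose_1)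
  finally have "(-1) ^ m * bernoulli m
      = bernoulli_functional (pcompose ([:0, 1:] ^ m) [:0, -1:])"
    by (metis bernoulli_functional_smult bernoulli_functional_x_power)
  \<comment> \<open>Expand \<open>x^m\<close> in the \<open>p_(k-1)\<close> first, then substitute
    \<open>-x\<close> termwise.\<close>
  also have "\<dots> = (\<Sum>k=1..Suc m. real (Stirling (Suc m) k)
      * bernoulli_functional (pcompose (falling_quot_poly (k - 1)) [:0, -1:]))"
    by (simp only: x_power_eq_sum_Stirling_falling_quot_poly pcompose_sum pcompose_smult
        bernoulli_functional_sum bernoulli_functional_smult)
  also have "\<dots> = - (\<Sum>k=1..Suc m. real (Stirling (Suc m) k) * (fact k / (real k)\<^sup>2) * (-1) ^ k)"
    unfolding sum_negf[symmetric]
  proof (rule sum.cong)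
    fix k assume "k \<in> {1..Suc m}"
    then obtain j where "k = Suc j"
      by (cases k) auto
    then show "real (Stirling (Suc m) k)
        * bernoulli_functional (pcompose (falling_quot_poly (k - 1)) [:0, -1:])
      = - (real (Stirling (Suc m) k) * (fact k / (real k)\<^sup>2) * (-1) ^ k)"
      by (simp add: bernoulli_functional_falling_quot_poly_reflect
          del: Stirling.simps fact_Suc of_nat_Suc)
  qed simp
  \<comment> \<open>A second factor \<open>(-1)^m\<close> isolates \<open>B_m\<close>, and with the
    minus sign it forms \<open>(-1)^(m+1)\<close>.\<close>
  finally have "(-1) ^ m * ((-1) ^ m * bernoulli m) = (-1) ^ m *
      - (\<Sum>k=1..Suc m. real (Stirling (Suc m) k) * (fact k / (real k)\<^sup>2) * (-1) ^ k)"
    by (rule arg_cong)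
  then show ?thesis
    by (simp del: Stirling.simps sum.cl_ivl_Suc flip: mult.assoc power_add)
qed

theorem theorem6:
  fixes n :: nat
  assumes "n \<ge> 1"
  shows
    "((\<Sum>k=1..n. real_of_int (signed_stirling n k) * bernoulli (k - 1))
        = (-1) ^ (n - 1) * fact (n - 1) * harm n) \<and>
     (bernoulli (n - 1)
        = (\<Sum>k=1..n. real (Stirling n k) * (-1) ^ (k - 1) * fact (k - 1) * harm k)) \<and>
     (bernoulli n
        = (\<Sum>k=1..n+1. real (Stirling (n + 1) k) * (-1) ^ (k - 1) * fact (k - 1) * harm k)) \<and>
     ((\<Sum>k=1..n. real_of_int (signed_stirling n k) * bernoulli (k - 1) * (-1) ^ k)
        = (-1) ^ n * fact n / (real n)\<^sup>2) \<and>
     (bernoulli (n - 1)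
        = (-1) ^ n * (\<Sum>k=1..n. real (Stirling n k) * (fact k / (real k)\<^sup>2) * (-1) ^ k)) \<and>
     (bernoulli n
        = (-1) ^ (n + 1) * (\<Sum>k=1..n+1. real (Stirling (n + 1) k) * (fact k / (real k)\<^sup>2) * (-1) ^ k))"
  \<comment> \<open>The two equivalent forms of (ii) and of (iv) are the instances
    \<open>m = n - 1\<close> and \<open>m = n\<close>.\<close>
  using assms sum_signed_stirling_bernoulli[OF assms]
    sum_signed_stirling_bernoulli_alternating[OF assms]
    bernoulli_eq_sum_Stirling_harm[of "n - 1"] bernoulli_eq_sum_Stirling_harm[of n]
    bernoulli_eq_sum_Stirling_fact[of "n - 1"] bernoulli_eq_sum_Stirling_fact[of n]
  by (simp only: Suc_diff_1 Suc_eq_plus1 le_add_diff_inverse2)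

end
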